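(* Let $A$ be a g-alternative algebra over a field $F$. If $\mathrm{Asoci}(A)=0$, then $\mathfrak{B}(A)$ (with its action on $A$) is an actor of $A$ in $\mathrm{gAlt}$.
   Context: Algebras: an algebra over a field $F$ is an $F$-vector space with an $F$-bilinear multiplication, not assumed associative or unital. $A$ is g-alternative if for all $x,y,z\in A$: $x(yz)=(xy)z+(yx)z-y(xz)$ and $(xy)z=x(yz)+x(zy)-(xz)y$. $\mathrm{gAlt}$ is the category of g-alternative algebras over $F$. Derived actions: an action of an $F$-algebra $B$ on a g-alternative algebra $A$, i.e. a pair of $F$-bilinear maps $B\times A\to A$, $(b,a)\mapsto ba$, and $A\times B\to A$, $(a,b)\mapsto ab$, is a derived action in $\mathrm{gAlt}$ if $B$ is g-alternative and for all $a,a_1,a_2\in A$, $b,b_1,b_2\in B$: $b(a_1a_2)=(ba_1)a_2+(a_1b)a_2-a_1(ba_2)$; $(a_1a_2)b=a_1(a_2b)+a_1(ba_2)-(a_1b)a_2$; $(ba_1)a_2=b(a_1a_2)+b(a_2a_1)-(ba_2)a_1$; $a_1(a_2b)=(a_1a_2)b+(a_2a_1)b-a_2(a_1b)$; $(b_1b_2)a=b_1(b_2a)+b_1(ab_2)-(b_1a)b_2$; $a(b_1b_2)=(ab_1)b_2+(b_1a)b_2-b_1(ab_2)$; $(ab_1)b_2=a(b_1b_2)+a(b_2b_1)-(ab_2)b_1$; $b_1(b_2a)=(b_1b_2)a+(b_2b_1)a-b_2(b_1a)$. ($A$ acts on itself by multiplication.) Let $\{B_i\}_{i\in I}$ be the family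 of all g-alternative algebras equipped with a derived action on $A$ in $\mathrm{gAlt}$. Actor: an actor of $A$ in $\mathrm{gAlt}$ is a g-alternative algebra $\mathrm{Act}(A)$ with a derived action on $A$ in $\mathrm{gAlt}$ such that for every g-alternative algebra $C$ with a derived action on $A$ there is a unique algebra homomorphism $\varphi\colon C\to\mathrm{Act}(A)$ with $ca=\varphi(c)a$ and $ac=a\varphi(c)$ for all $a\in A$, $c\in C$. $\mathfrak{B}(A)$: for a pair $f$ of $F$-linear maps $A\to A$ write $fa$ for the value of the first map at $a$ and $af$ for the value of the second. Each $b\in B_i$ gives the pair $(a\mapsto ba,\ a\mapsto ab)$; let $\mathbb{B}$ be the set of all pairs so obtained. On pairs define addition componentwise and a product $ff'$ by $(ff')a=f(f'a)+f(af')-(fa)f'$, $a(ff')=(af)f'+(fa)f'-f(af')$. Then $\mathfrak{B}(A)$ (the universal strict general actor of $A$) is the $F$-algebra of all pairs obtained from elements of $\mathbb{B}$ by repeatedly applying addition, negation and this product (pairs giving the same maps are identified). It acts on $A$ by $(f,a)\mapsto fa$, $(a,f)\mapsto af$. Substructure: a $\mathfrak{B}(A)$-substructure of $A$ is a subalgebra $A'\subseteq A$ with $fa\in A'$ and $af\in A'$ for all $f\in\mathfrak{B}(A)$, $a\in A'$. $\mathrm{Soci}(A)$ is the $\mathfrak{B}(A)$-substructure of $A$ generated by all elements of the forms $x(yz)+x(zy)$ and $(yz)x+(zy)x$ in which one of $x,y,z$ lies in $\bigcup_{i\in I}B_i$ and the other two lie in $A$. For $n\ge1$, $\mathrm{Asoci}^n(A)=\{x\in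 A\mid (\dots((xa_1)a_2)\dots)a_n\in\mathrm{Soci}(A)\text{ for all }a_1,\dots,a_n\in A\}$, and $\mathrm{Asoci}(A)=\bigcup_{n\ge1}\mathrm{Asoci}^n(A)$. *)

theory Defs
  imports "HOL-Algebra.Module"
begin

definition bilinear_map ::
    "('f, 'k) ring_scheme \<Rightarrow> ('f, 'x, 'm) module_scheme \<Rightarrow> ('f, 'y, 'n) module_scheme \<Rightarrow>
      ('f, 'z, 'p) module_scheme \<Rightarrow> ('x \<Rightarrow> 'y \<Rightarrow> 'z) \<Rightarrow> bool" where
  "bilinear_map F X Y Z h \<longleftrightarrow>
    (\<forall>x \<in> carrier X. \<forall>y \<in> carrier Y. h x y \<in> carrier Z) \<and>
    (\<forall>x \<in> carrier X. \<forall>x' \<in> carrier X. \<forall>y \<in> carrier Y. h (x \<oplus>\<^bsub>X\<^esub> x') y = h x y \<oplus>\<^bsub>Z\<^esub> h x' y) \<and>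
    (\<forall>x \<in> carrier X. \<forall>y \<in> carrier Y. \<forall>y' \<in> carrier Y. h x (y \<oplus>\<^bsub>Y\<^esub> y') = h x y \<oplus>\<^bsub>Z\<^esub> h x y') \<and>
    (\<forall>c \<in> carrier F. \<forall>x \<in> carrier X. \<forall>y \<in> carrier Y.
      h (c \<odot>\<^bsub>X\<^esub> x) y = c \<odot>\<^bsub>Z\<^esub> h x y \<and> h x (c \<odot>\<^bsub>Y\<^esub> y) = c \<odot>\<^bsub>Z\<^esub> h x y)"

text \<open>Algebras are carried by the record type of modules. Its multiplication is only required
  to be bilinear, and its field \<open>one\<close> is never used.\<close>

locale nonassoc_algebra = F?: field F + module F A
    for F :: "('f, 'k) ring_scheme" (structure) and A :: "('f, 'a, 'm) module_scheme" (structure) +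
  assumes mult_bilinear: "bilinear_map F A A A (mult A)"

locale g_alternative = nonassoc_algebra F A
    for F :: "('f, 'k) ring_scheme" (structure) and A :: "('f, 'a, 'm) module_scheme" (structure) +
  assumes g_alt_left: "\<lbrakk>x \<in> carrier A; y \<in> carrier A; z \<in> carrier A\<rbrakk> \<Longrightarrow>
      x \<otimes>\<^bsub>A\<^esub> (y \<otimes>\<^bsub>A\<^esub> z) =
        (x \<otimes>\<^bsub>A\<^esub> y) \<otimes>\<^bsub>A\<^esub> z \<oplus>\<^bsub>A\<^esub> (y \<otimes>\<^bsub>A\<^esub> x) \<otimes>\<^bsub>A\<^esub> z \<ominus>\<^bsub>A\<^esub> y \<otimes>\<^bsub>A\<^esub> (x \<otimes>\<^bsub>A\<^esub> z)"
    and g_alt_right: "\<lbrakk>x \<in> carrier A; y \<in> carrier A; z \<in> carrier A\<rbrakk> \<Longrightarrow>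
      (x \<otimes>\<^bsub>A\<^esub> y) \<otimes>\<^bsub>A\<^esub> z =
        x \<otimes>\<^bsub>A\<^esub> (y \<otimes>\<^bsub>A\<^esub> z) \<oplus>\<^bsub>A\<^esub> x \<otimes>\<^bsub>A\<^esub> (z \<otimes>\<^bsub>A\<^esub> y) \<ominus>\<^bsub>A\<^esub> (x \<otimes>\<^bsub>A\<^esub> z) \<otimes>\<^bsub>A\<^esub> y"

text \<open>The two maps of an action of \<open>B\<close> on \<open>A\<close> are \<open>b \<triangleright> a\<close> (written $ba$ on paper) and
  \<open>a \<triangleleft> b\<close> (written $ab$).\<close>

locale derived_action = A?: g_alternative F A + B?: g_alternative F B
    for F :: "('f, 'k) ring_scheme" and B :: "('f, 'b, 'n) module_scheme"
      and A :: "('f, 'a, 'm) module_scheme" +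
  fixes lact :: "'b \<Rightarrow> 'a \<Rightarrow> 'a" (infixl \<open>\<triangleright>\<close> 70)
    and ract :: "'a \<Rightarrow> 'b \<Rightarrow> 'a" (infixl \<open>\<triangleleft>\<close> 70)
  assumes lact_bilinear: "bilinear_map F B A A lact"
    and ract_bilinear: "bilinear_map F A B A ract"
    and act1: "\<lbrakk>b \<in> carrier B; a\<^sub>1 \<in> carrier A; a\<^sub>2 \<in> carrier A\<rbrakk> \<Longrightarrow>
      b \<triangleright> (a\<^sub>1 \<otimes>\<^bsub>A\<^esub> a\<^sub>2) = (b \<triangleright> a\<^sub>1) \<otimes>\<^bsub>A\<^esub> a\<^sub>2 \<oplus>\<^bsub>A\<^esub> (a\<^sub>1 \<triangleleft> b) \<otimes>\<^bsub>A\<^esub> a\<^sub>2 \<ominus>\<^bsub>A\<^esub> a\<^sub>1 \<otimes>\<^bsub>A\<^esub> (b \<triangleright> a\<^sub>2)"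
    and act2: "\<lbrakk>b \<in> carrier B; a\<^sub>1 \<in> carrier A; a\<^sub>2 \<in> carrier A\<rbrakk> \<Longrightarrow>
      (a\<^sub>1 \<otimes>\<^bsub>A\<^esub> a\<^sub>2) \<triangleleft> b = a\<^sub>1 \<otimes>\<^bsub>A\<^esub> (a\<^sub>2 \<triangleleft> b) \<oplus>\<^bsub>A\<^esub> a\<^sub>1 \<otimes>\<^bsub>A\<^esub> (b \<triangleright> a\<^sub>2) \<ominus>\<^bsub>A\<^esub> (a\<^sub>1 \<triangleleft> b) \<otimes>\<^bsub>A\<^esub> a\<^sub>2"
    and act3: "\<lbrakk>b \<in> carrier B; a\<^sub>1 \<in> carrier A; a\<^sub>2 \<in> carrier A\<rbrakk> \<Longrightarrow>
      (b \<triangleright> a\<^sub>1) \<otimes>\<^bsub>A\<^esub> a\<^sub>2 = b \<triangleright> (a\<^sub>1 \<otimes>\<^bsub>A\<^esub> a\<^sub>2) \<oplus>\<^bsub>A\<^esub> b \<triangleright> (a\<^sub>2 \<otimes>\<^bsub>A\<^esub> a\<^sub>1) \<ominus>\<^bsub>A\<^esub> (b \<triangleright> a\<^sub>2) \<otimes>\<^bsub>A\<^esub> a\<^sub>1"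
    and act4: "\<lbrakk>b \<in> carrier B; a\<^sub>1 \<in> carrier A; a\<^sub>2 \<in> carrier A\<rbrakk> \<Longrightarrow>
      a\<^sub>1 \<otimes>\<^bsub>A\<^esub> (a\<^sub>2 \<triangleleft> b) = (a\<^sub>1 \<otimes>\<^bsub>A\<^esub> a\<^sub>2) \<triangleleft> b \<oplus>\<^bsub>A\<^esub> (a\<^sub>2 \<otimes>\<^bsub>A\<^esub> a\<^sub>1) \<triangleleft> b \<ominus>\<^bsub>A\<^esub> a\<^sub>2 \<otimes>\<^bsub>A\<^esub> (a\<^sub>1 \<triangleleft> b)"
    and act5: "\<lbrakk>b\<^sub>1 \<in> carrier B; b\<^sub>2 \<in> carrier B; a \<in> carrier A\<rbrakk> \<Longrightarrow>
      (b\<^sub>1 \<otimes>\<^bsub>B\<^esub> b\<^sub>2) \<triangleright> a = b\<^sub>1 \<triangleright> (b\<^sub>2 \<triangleright> a) \<oplus>\<^bsub>A\<^esub> b\<^sub>1 \<triangleright> (a \<triangleleft> b\<^sub>2) \<ominus>\<^bsub>A\<^esub> (b\<^sub>1 \<triangleright> a) \<triangleleft> b\<^sub>2"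
    and act6: "\<lbrakk>b\<^sub>1 \<in> carrier B; b\<^sub>2 \<in> carrier B; a \<in> carrier A\<rbrakk> \<Longrightarrow>
      a \<triangleleft> (b\<^sub>1 \<otimes>\<^bsub>B\<^esub> b\<^sub>2) = (a \<triangleleft> b\<^sub>1) \<triangleleft> b\<^sub>2 \<oplus>\<^bsub>A\<^esub> (b\<^sub>1 \<triangleright> a) \<triangleleft> b\<^sub>2 \<ominus>\<^bsub>A\<^esub> b\<^sub>1 \<triangleright> (a \<triangleleft> b\<^sub>2)"
    and act7: "\<lbrakk>b\<^sub>1 \<in> carrier B; b\<^sub>2 \<in> carrier B; a \<in> carrier A\<rbrakk> \<Longrightarrow>
      (a \<triangleleft> b\<^sub>1) \<triangleleft> b\<^sub>2 = a \<triangleleft> (b\<^sub>1 \<otimes>\<^bsub>B\<^esub> b\<^sub>2) \<oplus>\<^bsub>A\<^esub> a \<triangleleft> (b\<^sub>2 \<otimes>\<^bsub>B\<^esub> b\<^sub>1) \<ominus>\<^bsub>A\<^esub> (a \<triangleleft> b\<^sub>2) \<triangleleft> b\<^sub>1"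
    and act8: "\<lbrakk>b\<^sub>1 \<in> carrier B; b\<^sub>2 \<in> carrier B; a \<in> carrier A\<rbrakk> \<Longrightarrow>
      b\<^sub>1 \<triangleright> (b\<^sub>2 \<triangleright> a) = (b\<^sub>1 \<otimes>\<^bsub>B\<^esub> b\<^sub>2) \<triangleright> a \<oplus>\<^bsub>A\<^esub> (b\<^sub>2 \<otimes>\<^bsub>B\<^esub> b\<^sub>1) \<triangleright> a \<ominus>\<^bsub>A\<^esub> b\<^sub>2 \<triangleright> (b\<^sub>1 \<triangleright> a)"

text \<open>Maps of a pair are restricted to the carrier of \<open>A\<close>, so that pairs giving the same maps on
  \<open>A\<close> are equal.\<close>

type_synonym 'a act_pair = "('a \<Rightarrow> 'a) \<times> ('a \<Rightarrow> 'a)"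

definition action_pairs ::
    "'b itself \<Rightarrow> ('f, 'k) ring_scheme \<Rightarrow> ('f, 'a, 'm) module_scheme \<Rightarrow> 'a act_pair set" where
  "action_pairs _ F A =
    {(\<lambda>a \<in> carrier A. lact b a, \<lambda>a \<in> carrier A. ract a b) | (B :: ('f, 'b) module) lact ract b.
      derived_action F B A lact ract \<and> b \<in> carrier B}"

text \<open>A formula cannot quantify over the types carrying the acting algebras \<open>B\<close>, so the family of
  all \<open>B\<close> is represented by those on one type. Each pair comes already from the
  subalgebra generated by a single \<open>b\<close>, whose elements are values of the terms below; hence
  acting algebras with carriers of terms give all pairs, as
  \<open>action_pairs_subset_all_action_pairs\<close> confirms for acting algebras on an
  arbitrary type.\<close>

datatype 'f alg_term =
    Gen
  | Scale 'f "'f alg_term"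
  | Add "'f alg_term" "'f alg_term"
  | Mult "'f alg_term" "'f alg_term"

definition all_action_pairs ::
    "('f, 'k) ring_scheme \<Rightarrow> ('f, 'a, 'm) module_scheme \<Rightarrow> 'a act_pair set" where
  "all_action_pairs F A = action_pairs TYPE('f alg_term) F A"

lemma derived_action_pullback:
  fixes F :: "('f, 'k) ring_scheme" and A :: "('f, 'a, 'm) module_scheme"
    and C :: "('f, 'c, 'n) module_scheme" and U :: "('f, 'u, 'p) module_scheme"
  assumes act: "derived_action F C A lact ract"
    and inj: "inj_on g (carrier U)"
    and g_closed: "\<And>u. u \<in> carrier U \<Longrightarrow> g u \<in> carrier C"
    and zero: "\<zero>\<^bsub>U\<^esub> \<in> carrier U" "g \<zero>\<^bsub>U\<^esub> = \<zero>\<^bsub>C\<^esub>"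
    and add: "\<And>u v. u \<in> carrier U \<Longrightarrow> v \<in> carrier U \<Longrightarrow> u \<oplus>\<^bsub>U\<^esub> v \<in> carrier U"
      "\<And>u v. u \<in> carrier U \<Longrightarrow> v \<in> carrier U \<Longrightarrow> g (u \<oplus>\<^bsub>U\<^esub> v) = g u \<oplus>\<^bsub>C\<^esub> g v"
    and mult: "\<And>u v. u \<in> carrier U \<Longrightarrow> v \<in> carrier U \<Longrightarrow> u \<otimes>\<^bsub>U\<^esub> v \<in> carrier U"
      "\<And>u v. u \<in> carrier U \<Longrightarrow> v \<in> carrier U \<Longrightarrow> g (u \<otimes>\<^bsub>U\<^esub> v) = g u \<otimes>\<^bsub>C\<^esub> g v"
    and smult: "\<And>k u. k \<in> carrier F \<Longrightarrow> u \<in> carrier U \<Longrightarrow> k \<odot>\<^bsub>U\<^esub> u \<in> carrier U"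
      "\<And>k u. k \<in> carrier F \<Longrightarrow> u \<in> carrier U \<Longrightarrow> g (k \<odot>\<^bsub>U\<^esub> u) = k \<odot>\<^bsub>C\<^esub> g u"
  shows "derived_action F U A (\<lambda>u. lact (g u)) (\<lambda>a u. ract a (g u))"
proof -
  interpret D: derived_action F C A lact ract by (rule act)
  note h = g_closed zero add mult smult
  have eqI: "u = v" if "g u = g v" "u \<in> carrier U" "v \<in> carrier U" for u v
    using inj that by (auto dest: inj_onD)
  have neg: "(\<ominus>\<^bsub>F\<^esub> \<one>\<^bsub>F\<^esub>) \<odot>\<^bsub>U\<^esub> u \<oplus>\<^bsub>U\<^esub> u = \<zero>\<^bsub>U\<^esub>" if "u \<in> carrier U" for u
    using that
    by (intro eqI) (simp_all add: h D.B.smult_l_minus D.B.M.l_neg)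
  interpret ag: abelian_group U
  proof (rule abelian_groupI)
    show "\<exists>y\<in>carrier U. y \<oplus>\<^bsub>U\<^esub> x = \<zero>\<^bsub>U\<^esub>" if "x \<in> carrier U" for x
      using neg[OF that] smult(1)[of "\<ominus>\<^bsub>F\<^esub> \<one>\<^bsub>F\<^esub>" x] that by blast
  qed (auto intro!: eqI simp: h D.B.M.a_ac)
  have inv: "g (\<ominus>\<^bsub>U\<^esub> u) = \<ominus>\<^bsub>C\<^esub> g u" if "u \<in> carrier U" for u
  proof -
    have "g (\<ominus>\<^bsub>U\<^esub> u) \<oplus>\<^bsub>C\<^esub> g u = \<zero>\<^bsub>C\<^esub>"
      using that add(2)[of "\<ominus>\<^bsub>U\<^esub> u" u] by (simp add: ag.l_neg zero)
    then show ?thesis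
      using that by (simp add: h D.B.M.minus_equality)
  qed
  have minus: "g (u \<ominus>\<^bsub>U\<^esub> v) = g u \<ominus>\<^bsub>C\<^esub> g v" if "u \<in> carrier U" "v \<in> carrier U" for u v
    using that by (simp add: a_minus_def h inv)
  have modU: "module F U"
  proof (rule moduleI)
    show "cring F" using D.B.nonassoc_algebra_axioms by (simp add: nonassoc_algebra_def module_def)
    show "abelian_group U" by (rule ag.abelian_group_axioms)
  qed (auto intro!: eqI simp: h D.B.smult_l_distr D.B.smult_r_distr D.B.smult_assoc1)
  have bilC: "bilinear_map F C C C (mult C)" by (rule D.B.mult_bilinear)
  have naU: "nonassoc_algebra F U"
  proof (intro nonassoc_algebra.intro nonassoc_algebra_axioms.intro modU)
    show "field F" using D.B.nonassoc_algebra_axioms by (simp add: nonassoc_algebra_def)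
    show "bilinear_map F U U U (mult U)"
      using bilC unfolding bilinear_map_def by (auto intro!: eqI simp: h)
  qed
  have gaU: "g_alternative F U"
  proof (intro g_alternative.intro naU g_alternative_axioms.intro)
    fix x y z assume [simp]: "x \<in> carrier U" "y \<in> carrier U" "z \<in> carrier U"
    show "x \<otimes>\<^bsub>U\<^esub> (y \<otimes>\<^bsub>U\<^esub> z) =
        (x \<otimes>\<^bsub>U\<^esub> y) \<otimes>\<^bsub>U\<^esub> z \<oplus>\<^bsub>U\<^esub> (y \<otimes>\<^bsub>U\<^esub> x) \<otimes>\<^bsub>U\<^esub> z \<ominus>\<^bsub>U\<^esub> y \<otimes>\<^bsub>U\<^esub> (x \<otimes>\<^bsub>U\<^esub> z)"
      by (rule eqI) (simp_all add: h minus D.B.g_alt_left[of "g x" "g y" "g z"])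
    show "(x \<otimes>\<^bsub>U\<^esub> y) \<otimes>\<^bsub>U\<^esub> z =
        x \<otimes>\<^bsub>U\<^esub> (y \<otimes>\<^bsub>U\<^esub> z) \<oplus>\<^bsub>U\<^esub> x \<otimes>\<^bsub>U\<^esub> (z \<otimes>\<^bsub>U\<^esub> y) \<ominus>\<^bsub>U\<^esub> (x \<otimes>\<^bsub>U\<^esub> z) \<otimes>\<^bsub>U\<^esub> y"
      by (rule eqI) (simp_all add: h minus D.B.g_alt_right[of "g x" "g y" "g z"])
  qed
  show ?thesis
  proof (intro derived_action.intro derived_action_axioms.intro gaU)
    show "g_alternative F A" by (rule D.A.g_alternative_axioms)
    show "bilinear_map F U A A (\<lambda>u. lact (g u))"
      using D.lact_bilinear unfolding bilinear_map_def by (auto simp: h)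
    show "bilinear_map F A U A (\<lambda>a u. ract a (g u))"
      using D.ract_bilinear unfolding bilinear_map_def by (auto simp: h)
  qed (simp_all add: h,
       (rule D.act1 D.act2 D.act3 D.act4 D.act5 D.act6 D.act7 D.act8; simp add: h)+)
qed

primrec term_value :: "('f, 'c, 'n) module_scheme \<Rightarrow> 'c \<Rightarrow> 'f alg_term \<Rightarrow> 'c" where
  "term_value C c Gen = c"
| "term_value C c (Scale k t) = k \<odot>\<^bsub>C\<^esub> term_value C c t"
| "term_value C c (Add s t) = term_value C c s \<oplus>\<^bsub>C\<^esub> term_value C c t"
| "term_value C c (Mult s t) = term_value C c s \<otimes>\<^bsub>C\<^esub> term_value C c t"

lemma action_pairs_subset_all_action_pairs:
  fixes F :: "('f, 'k) ring_scheme" and A :: "('f, 'a, 'm) module_scheme"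
  shows "action_pairs TYPE('c) F A \<subseteq> all_action_pairs F A"
proof
  fix p assume "p \<in> action_pairs TYPE('c) F A"
  then obtain C :: "('f, 'c) module" and lact ract c
    where p: "p = (\<lambda>a \<in> carrier A. lact c a, \<lambda>a \<in> carrier A. ract a c)"
      and act: "derived_action F C A lact ract" and c: "c \<in> carrier C"
    unfolding action_pairs_def by blast
  interpret D: derived_action F C A lact ract by (rule act)
  define T where "T = {t :: 'f alg_term. set_alg_term t \<subseteq> carrier F}"
  define ev where "ev = term_value C c"
  define rep where "rep x = (SOME t. t \<in> T \<and> ev t = x)" for x
  define S where "S = ev ` T"
  have bil: "bilinear_map F C C C (mult C)" by (rule D.B.mult_bilinear)
  have ev_closed: "ev t \<in> carrier C" if "t \<in> T" for t
    using that
  proof (induction t)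
    case Gen
    then show ?case using c by (simp add: ev_def)
  next
    case (Mult s t)
    then show ?case using bil unfolding bilinear_map_def by (auto simp: ev_def T_def)
  qed (auto simp: ev_def T_def)
  have rep: "rep x \<in> T" "ev (rep x) = x" if "x \<in> S" for x
    using someI_ex[of "\<lambda>t. t \<in> T \<and> ev t = x"] that unfolding rep_def S_def by blast+
  have SI: "ev t \<in> S" if "t \<in> T" for t using that by (simp add: S_def)
  have SC: "x \<in> carrier C" if "x \<in> S" for x using that ev_closed by (auto simp: S_def)
  have cS: "c \<in> S" using SI[of Gen] by (simp add: T_def ev_def)
  have addS: "x \<oplus>\<^bsub>C\<^esub> y \<in> S" if "x \<in> S" "y \<in> S" for x y
    using SI[of "Add (rep x) (rep y)"] rep[OF that(1)] rep[OF that(2)]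
    by (simp add: T_def ev_def)
  have multS: "x \<otimes>\<^bsub>C\<^esub> y \<in> S" if "x \<in> S" "y \<in> S" for x y
    using SI[of "Mult (rep x) (rep y)"] rep[OF that(1)] rep[OF that(2)]
    by (simp add: T_def ev_def)
  have smultS: "k \<odot>\<^bsub>C\<^esub> x \<in> S" if "k \<in> carrier F" "x \<in> S" for k x
    using SI[of "Scale k (rep x)"] rep[OF that(2)] that(1)
    by (simp add: T_def ev_def)
  have zeroS: "\<zero>\<^bsub>C\<^esub> \<in> S"
    using smultS[OF _ cS, of "\<zero>\<^bsub>F\<^esub>"] c by simp
  define U :: "('f, 'f alg_term) module" where
    "U = \<lparr>carrier = rep ` S, mult = (\<lambda>s t. rep (ev s \<otimes>\<^bsub>C\<^esub> ev t)), one = undefined,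
      zero = rep \<zero>\<^bsub>C\<^esub>, add = (\<lambda>s t. rep (ev s \<oplus>\<^bsub>C\<^esub> ev t)),
      smult = (\<lambda>k t. rep (k \<odot>\<^bsub>C\<^esub> ev t))\<rparr>"
  have "derived_action F U A (\<lambda>u. lact (ev u)) (\<lambda>a u. ract a (ev u))"
  proof (rule derived_action_pullback[OF act])
    show "inj_on ev (carrier U)" by (auto simp: U_def inj_on_def rep)
  qed (auto simp: U_def rep zeroS addS multS smultS SC)
  moreover have "rep c \<in> carrier U" using cS by (simp add: U_def)
  ultimately have "(\<lambda>a \<in> carrier A. lact (ev (rep c)) a, \<lambda>a \<in> carrier A. ract a (ev (rep c)))
      \<in> all_action_pairs F A"
    unfolding all_action_pairs_def action_pairs_def mem_Collect_eq
    by (intro exI[of _ U] exI[of _ "\<lambda>u. lact (ev u)"] exI[of _ "\<lambda>a u. ract a (ev u)"]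
        exI[of _ "rep c"]) simp
  then show "p \<in> all_action_pairs F A"
    using p rep(2)[OF cS] by simp
qed

definition pair_add :: "('f, 'a, 'm) module_scheme \<Rightarrow> 'a act_pair \<Rightarrow> 'a act_pair \<Rightarrow> 'a act_pair" where
  "pair_add A p q =
    (\<lambda>a \<in> carrier A. fst p a \<oplus>\<^bsub>A\<^esub> fst q a, \<lambda>a \<in> carrier A. snd p a \<oplus>\<^bsub>A\<^esub> snd q a)"

definition pair_neg :: "('f, 'a, 'm) module_scheme \<Rightarrow> 'a act_pair \<Rightarrow> 'a act_pair" where
  "pair_neg A p = (\<lambda>a \<in> carrier A. \<ominus>\<^bsub>A\<^esub> fst p a, \<lambda>a \<in> carrier A. \<ominus>\<^bsub>A\<^esub> snd p a)"

definition pair_mult :: "('f, 'a, 'm) module_scheme \<Rightarrow> 'a act_pair \<Rightarrow> 'a act_pair \<Rightarrow> 'a act_pair" where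
  "pair_mult A p q =
    (\<lambda>a \<in> carrier A. fst p (fst q a) \<oplus>\<^bsub>A\<^esub> fst p (snd q a) \<ominus>\<^bsub>A\<^esub> snd q (fst p a),
     \<lambda>a \<in> carrier A. snd q (snd p a) \<oplus>\<^bsub>A\<^esub> snd q (fst p a) \<ominus>\<^bsub>A\<^esub> fst p (snd q a))"

inductive_set usga_carrier ::
    "('f, 'k) ring_scheme \<Rightarrow> ('f, 'a, 'm) module_scheme \<Rightarrow> 'a act_pair set"
    for F :: "('f, 'k) ring_scheme" and A :: "('f, 'a, 'm) module_scheme" where
  base: "p \<in> all_action_pairs F A \<Longrightarrow> p \<in> usga_carrier F A"
| add: "\<lbrakk>p \<in> usga_carrier F A; q \<in> usga_carrier F A\<rbrakk> \<Longrightarrow> pair_add A p q \<in> usga_carrier F A"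
| neg: "p \<in> usga_carrier F A \<Longrightarrow> pair_neg A p \<in> usga_carrier F A"
| mult: "\<lbrakk>p \<in> usga_carrier F A; q \<in> usga_carrier F A\<rbrakk> \<Longrightarrow> pair_mult A p q \<in> usga_carrier F A"

text \<open>The universal strict general actor $\mathfrak{B}(A)$ and its action on \<open>A\<close>.\<close>

definition usga ::
    "('f, 'k) ring_scheme \<Rightarrow> ('f, 'a, 'm) module_scheme \<Rightarrow> ('f, 'a act_pair) module" where
  "usga F A =
    \<lparr>carrier = usga_carrier F A, mult = pair_mult A, one = undefined,
     zero = (\<lambda>a \<in> carrier A. \<zero>\<^bsub>A\<^esub>, \<lambda>a \<in> carrier A. \<zero>\<^bsub>A\<^esub>), add = pair_add A,
     smult = (\<lambda>c p. (\<lambda>a \<in> carrier A. c \<odot>\<^bsub>A\<^esub> fst p a, \<lambda>a \<in> carrier A. c \<odot>\<^bsub>A\<^esub> snd p a))\<rparr>"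

definition usga_lact :: "'a act_pair \<Rightarrow> 'a \<Rightarrow> 'a" where
  "usga_lact p a = fst p a"

definition usga_ract :: "'a \<Rightarrow> 'a act_pair \<Rightarrow> 'a" where
  "usga_ract a p = snd p a"

definition usga_substructure ::
    "('f, 'k) ring_scheme \<Rightarrow> ('f, 'a, 'm) module_scheme \<Rightarrow> 'a set \<Rightarrow> bool" where
  "usga_substructure F A S \<longleftrightarrow>
    submodule S F A \<and> (\<forall>x \<in> S. \<forall>y \<in> S. x \<otimes>\<^bsub>A\<^esub> y \<in> S) \<and>
    (\<forall>p \<in> carrier (usga F A). \<forall>a \<in> S. usga_lact p a \<in> S \<and> usga_ract a p \<in> S)"

text \<open>The two forms $x(yz)+x(zy)$ and $(yz)x+(zy)x$, first with $x$, then with $y$,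
  then with $z$ the element of the acting algebra, which enters only through its pair \<open>p\<close>.\<close>

definition Soci_generators ::
    "('f, 'k) ring_scheme \<Rightarrow> ('f, 'a, 'm) module_scheme \<Rightarrow> 'a set" where
  "Soci_generators F A =
    (\<Union>p \<in> all_action_pairs F A. \<Union>u \<in> carrier A. \<Union>v \<in> carrier A.
      {fst p (u \<otimes>\<^bsub>A\<^esub> v) \<oplus>\<^bsub>A\<^esub> fst p (v \<otimes>\<^bsub>A\<^esub> u),
       snd p (u \<otimes>\<^bsub>A\<^esub> v) \<oplus>\<^bsub>A\<^esub> snd p (v \<otimes>\<^bsub>A\<^esub> u),
       u \<otimes>\<^bsub>A\<^esub> fst p v \<oplus>\<^bsub>A\<^esub> u \<otimes>\<^bsub>A\<^esub> snd p v,
       fst p v \<otimes>\<^bsub>A\<^esub> u \<oplus>\<^bsub>A\<^esub> snd p v \<otimes>\<^bsub>A\<^esub> u,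
       u \<otimes>\<^bsub>A\<^esub> snd p v \<oplus>\<^bsub>A\<^esub> u \<otimes>\<^bsub>A\<^esub> fst p v,
       snd p v \<otimes>\<^bsub>A\<^esub> u \<oplus>\<^bsub>A\<^esub> fst p v \<otimes>\<^bsub>A\<^esub> u})"

definition Soci :: "('f, 'k) ring_scheme \<Rightarrow> ('f, 'a, 'm) module_scheme \<Rightarrow> 'a set" where
  "Soci F A = \<Inter> {S. usga_substructure F A S \<and> Soci_generators F A \<subseteq> S}"

definition Asoci_n :: "('f, 'k) ring_scheme \<Rightarrow> ('f, 'a, 'm) module_scheme \<Rightarrow> nat \<Rightarrow> 'a set" where
  "Asoci_n F A n =
    {x \<in> carrier A. \<forall>as. length as = n \<and> set as \<subseteq> carrier A \<longrightarrow> foldl (mult A) x as \<in> Soci F A}"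

definition Asoci :: "('f, 'k) ring_scheme \<Rightarrow> ('f, 'a, 'm) module_scheme \<Rightarrow> 'a set" where
  "Asoci F A = (\<Union>n \<in> {1..}. Asoci_n F A n)"

text \<open>Homomorphisms are extensional functions, so that uniqueness refers to their values on the
  carrier only.\<close>

definition alg_hom ::
    "('f, 'k) ring_scheme \<Rightarrow> ('f, 'c, 'm) module_scheme \<Rightarrow> ('f, 'd, 'n) module_scheme \<Rightarrow>
      ('c \<Rightarrow> 'd) set" where
  "alg_hom F C D =
    {\<phi> \<in> carrier C \<rightarrow>\<^sub>E carrier D.
      (\<forall>x \<in> carrier C. \<forall>y \<in> carrier C.
        \<phi> (x \<oplus>\<^bsub>C\<^esub> y) = \<phi> x \<oplus>\<^bsub>D\<^esub> \<phi> y \<and> \<phi> (x \<otimes>\<^bsub>C\<^esub> y) = \<phi> x \<otimes>\<^bsub>D\<^esub> \<phi> y) \<and>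
      (\<forall>k \<in> carrier F. \<forall>x \<in> carrier C. \<phi> (k \<odot>\<^bsub>C\<^esub> x) = k \<odot>\<^bsub>D\<^esub> \<phi> x)}"

text \<open>Here \<open>C\<close> ranges over the algebras with elements in the type \<open>'c\<close>; being an
  actor means satisfying this for every type \<open>'c\<close>.\<close>

definition is_actor ::
    "'c itself \<Rightarrow> ('f, 'k) ring_scheme \<Rightarrow> ('f, 'a, 'm) module_scheme \<Rightarrow>
      ('f, 'd, 'n) module_scheme \<Rightarrow> ('d \<Rightarrow> 'a \<Rightarrow> 'a) \<Rightarrow> ('a \<Rightarrow> 'd \<Rightarrow> 'a) \<Rightarrow> bool" where
  "is_actor _ F A D lact ract \<longleftrightarrow>
    derived_action F D A lact ract \<and>
    (\<forall>(C :: ('f, 'c) module) lactC ractC. derived_action F C A lactC ractC \<longrightarrow>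
      (\<exists>!\<phi>. \<phi> \<in> alg_hom F C D \<and>
        (\<forall>c \<in> carrier C. \<forall>a \<in> carrier A.
          lactC c a = lact (\<phi> c) a \<and> ractC a c = ract a (\<phi> c))))"

end

theory Submission
  imports Defs
begin

text \<open>If $\mathrm{Asoci}(A) = 0$, then only $0$ annihilates $A$ from the left, and $\mathrm{Soci}(A)$,
  being an ideal, vanishes. Hence $ba + ab = 0$ for every acting $b$; in particular $A$ is
  anticommutative, and then $(xy)z = -x(yz)$. The pentagon of rebracketings of four factors gives
  $2((xy)z)w = 0$, hence $2A = 0$, so that $A$ is commutative and associative. Every acting element
  acts on both sides by one multiplier $f(xy) = x f(y)$, multipliers commute because annihilators
  vanish, and on pairs $(f, f)$ the product of $\mathfrak{B}(A)$ is composition. All identities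
  of a derived action then reduce to $2A = 0$.\<close>

section \<open>Bilinearity rules for the multiplication\<close>

context nonassoc_algebra
begin

lemma mult_closed [simp, intro]:
  "\<lbrakk>x \<in> carrier A; y \<in> carrier A\<rbrakk> \<Longrightarrow> x \<otimes>\<^bsub>A\<^esub> y \<in> carrier A"
  using mult_bilinear unfolding bilinear_map_def by blast

lemma mult_l_distr:
  "\<lbrakk>x \<in> carrier A; y \<in> carrier A; z \<in> carrier A\<rbrakk> \<Longrightarrow>
    (x \<oplus>\<^bsub>A\<^esub> y) \<otimes>\<^bsub>A\<^esub> z = x \<otimes>\<^bsub>A\<^esub> z \<oplus>\<^bsub>A\<^esub> y \<otimes>\<^bsub>A\<^esub> z"
  using mult_bilinear unfolding bilinear_map_def by blast

lemma mult_r_distr: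
  "\<lbrakk>x \<in> carrier A; y \<in> carrier A; z \<in> carrier A\<rbrakk> \<Longrightarrow>
    x \<otimes>\<^bsub>A\<^esub> (y \<oplus>\<^bsub>A\<^esub> z) = x \<otimes>\<^bsub>A\<^esub> y \<oplus>\<^bsub>A\<^esub> x \<otimes>\<^bsub>A\<^esub> z"
  using mult_bilinear unfolding bilinear_map_def by blast

lemma mult_zero_l: "x \<in> carrier A \<Longrightarrow> \<zero>\<^bsub>A\<^esub> \<otimes>\<^bsub>A\<^esub> x = \<zero>\<^bsub>A\<^esub>"
  using mult_l_distr[of "\<zero>\<^bsub>A\<^esub>" "\<zero>\<^bsub>A\<^esub>" x] by simp

lemma mult_zero_r: "x \<in> carrier A \<Longrightarrow> x \<otimes>\<^bsub>A\<^esub> \<zero>\<^bsub>A\<^esub> = \<zero>\<^bsub>A\<^esub>"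
  using mult_r_distr[of x "\<zero>\<^bsub>A\<^esub>" "\<zero>\<^bsub>A\<^esub>"] by simp

end

section \<open>Multiplications of \<open>A\<close> as acting elements\<close>

text \<open>With \<open>A\<close> acting on itself, each of the eight action identities is an
  instance of one of the two g-alternative identities.\<close>

lemma (in g_alternative) derived_action_self: "derived_action F A A (mult A) (mult A)"
  by (intro derived_action.intro derived_action_axioms.intro g_alternative_axioms mult_bilinear)
     (rule g_alt_left g_alt_right; assumption)+

text \<open>This brings the two multiplications by an element of \<open>A\<close> into B(A). Hence
  \<open>Soci\<close> absorbs products with elements of \<open>A\<close>, and every statement about
  acting elements specializes to elements of \<open>A\<close>.\<close>

lemma mult_in_all_action_pairs:
  fixes F :: "('f, 'k) ring_scheme" and A :: "('f, 'a, 'm) module_scheme"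
  assumes "g_alternative F A" and "b \<in> carrier A"
  shows "(\<lambda>a \<in> carrier A. b \<otimes>\<^bsub>A\<^esub> a, \<lambda>a \<in> carrier A. a \<otimes>\<^bsub>A\<^esub> b) \<in> all_action_pairs F A"
proof -
  interpret g_alternative F A by (rule assms(1))
  \<comment> \<open>\<open>action_pairs\<close> ranges over plain \<open>module\<close> records,
    while \<open>A\<close> may carry further fields. The algebra is therefore copied into such a
    record, and the action is pulled back along the identity.\<close>
  define U :: "('f, 'a) module" where
    "U = \<lparr>carrier = carrier A, mult = mult A, one = undefined, zero = \<zero>\<^bsub>A\<^esub>, add = add A, smult = smult A\<rparr>"
  have "derived_action F U A (\<lambda>u. mult A ((\<lambda>x. x) u)) (\<lambda>a u. mult A a ((\<lambda>x. x) u))"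
    by (rule derived_action_pullback[OF derived_action_self, of "\<lambda>x. x" U])
       (auto simp: U_def)
  moreover have "b \<in> carrier U"
    using assms by (simp add: U_def)
  ultimately have "(\<lambda>a \<in> carrier A. b \<otimes>\<^bsub>A\<^esub> a, \<lambda>a \<in> carrier A. a \<otimes>\<^bsub>A\<^esub> b) \<in> action_pairs TYPE('a) F A"
    unfolding action_pairs_def by blast
  then show ?thesis
    using action_pairs_subset_all_action_pairs by blast
qed

section \<open>Annihilators and the vanishing of the generators of \<open>Soci\<close>\<close>

locale asoci_zero = g_alternative F A
    for F :: "('f, 'k) ring_scheme" (structure) and A :: "('f, 'a, 'm) module_scheme" (structure) +
  assumes Asoci_zero: "Asoci F A = {\<zero>\<^bsub>A\<^esub>}"
begin

text \<open>Such an element lies in the first layer \<open>Asoci_n F A 1\<close>, hence in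
  \<open>Asoci\<close>.\<close>

lemma zero_if_mult_in_Soci:
  assumes "x \<in> carrier A" "\<And>a. a \<in> carrier A \<Longrightarrow> x \<otimes>\<^bsub>A\<^esub> a \<in> Soci F A"
  shows "x = \<zero>\<^bsub>A\<^esub>"
proof -
  have "x \<in> Asoci_n F A 1"
    using assms by (auto simp: Asoci_n_def length_Suc_conv)
  then have "x \<in> Asoci F A"
    unfolding Asoci_def by blast
  then show ?thesis
    using Asoci_zero by blast
qed

text \<open>\<open>Soci\<close> contains 0, being an intersection of submodules. This is the
  cancellation rule behind most later steps: an element vanishes as soon as all its right multiples
  do.\<close>

lemma zero_if_annihilates:
  assumes "x \<in> carrier A" "\<And>a. a \<in> carrier A \<Longrightarrow> x \<otimes>\<^bsub>A\<^esub> a = \<zero>\<^bsub>A\<^esub>"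
  shows "x = \<zero>\<^bsub>A\<^esub>"
proof -
  have "\<zero>\<^bsub>A\<^esub> \<in> Soci F A"
    unfolding Soci_def usga_substructure_def
    using subgroup.one_closed[of _ "add_monoid A", OF submodule.axioms(1)] by auto
  then show ?thesis
    using assms by (intro zero_if_mult_in_Soci) simp_all
qed

text \<open>Right multiplication by \<open>a\<close> is the right action of an element of B(A), so
  every substructure containing \<open>x\<close> contains all right multiples of
  \<open>x\<close>.\<close>

lemma Soci_generator_zero:
  assumes "x \<in> Soci_generators F A" "x \<in> carrier A"
  shows "x = \<zero>\<^bsub>A\<^esub>"
proof (rule zero_if_mult_in_Soci)
  fix a assume a: "a \<in> carrier A"
  show "x \<otimes>\<^bsub>A\<^esub> a \<in> Soci F A"
    unfolding Soci_def
  proof (rule InterI, clarify)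
    fix S assume S: "usga_substructure F A S" and "Soci_generators F A \<subseteq> S"
    then have "x \<in> S"
      using assms by blast
    moreover have "(\<lambda>c \<in> carrier A. a \<otimes>\<^bsub>A\<^esub> c, \<lambda>c \<in> carrier A. c \<otimes>\<^bsub>A\<^esub> a) \<in> carrier (usga F A)"
      using mult_in_all_action_pairs[OF g_alternative_axioms a] by (simp add: usga_def usga_carrier.base)
    ultimately show "x \<otimes>\<^bsub>A\<^esub> a \<in> S"
      using S assms(2) unfolding usga_substructure_def usga_ract_def by fastforce
  qed
qed (rule assms(2))

text \<open>The product of the sum with any \<open>u\<close> is a generator of \<open>Soci\<close>
  of the form (yz)x + (zy)x, hence zero; the sum thus annihilates \<open>A\<close> from the
  left.\<close>

lemma action_pair_anticommute:
  assumes p: "p \<in> all_action_pairs F A" and v: "v \<in> carrier A"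
    and closed: "fst p v \<in> carrier A" "snd p v \<in> carrier A"
  shows "fst p v \<oplus>\<^bsub>A\<^esub> snd p v = \<zero>\<^bsub>A\<^esub>"
proof (rule zero_if_annihilates)
  fix u assume u: "u \<in> carrier A"
  have "fst p v \<otimes>\<^bsub>A\<^esub> u \<oplus>\<^bsub>A\<^esub> snd p v \<otimes>\<^bsub>A\<^esub> u \<in> Soci_generators F A"
    unfolding Soci_generators_def using p u v by blast
  then show "(fst p v \<oplus>\<^bsub>A\<^esub> snd p v) \<otimes>\<^bsub>A\<^esub> u = \<zero>\<^bsub>A\<^esub>"
    using u closed by (simp add: Soci_generator_zero mult_l_distr)
qed (use closed in simp)

section \<open>Anticommutativity, antiassociativity and 2A = 0\<close>

lemma anticommute:
  assumes "x \<in> carrier A" "y \<in> carrier A"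
  shows "x \<otimes>\<^bsub>A\<^esub> y \<oplus>\<^bsub>A\<^esub> y \<otimes>\<^bsub>A\<^esub> x = \<zero>\<^bsub>A\<^esub>"
  using action_pair_anticommute[OF mult_in_all_action_pairs[OF g_alternative_axioms assms(1)] assms(2)]
    mult_closed[OF assms] mult_closed[OF assms(2,1)]
  by (simp only: restrict_apply' fst_conv snd_conv assms)

text \<open>Anticommutativity cancels two terms in each g-alternative identity. What remains of the
  right one is (xy)z = -(xz)y, which equals y(xz); what remains of the left one is y(xz) =
  -x(yz).\<close>

lemma antiassoc:
  assumes [simp]: "x \<in> carrier A" "y \<in> carrier A" "z \<in> carrier A"
  shows "(x \<otimes>\<^bsub>A\<^esub> y) \<otimes>\<^bsub>A\<^esub> z = \<ominus>\<^bsub>A\<^esub> (x \<otimes>\<^bsub>A\<^esub> (y \<otimes>\<^bsub>A\<^esub> z))"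
proof -
  have "x \<otimes>\<^bsub>A\<^esub> (y \<otimes>\<^bsub>A\<^esub> z) \<oplus>\<^bsub>A\<^esub> x \<otimes>\<^bsub>A\<^esub> (z \<otimes>\<^bsub>A\<^esub> y) = \<zero>\<^bsub>A\<^esub>"
    by (simp add: anticommute mult_zero_r flip: mult_r_distr)
  then have "(x \<otimes>\<^bsub>A\<^esub> y) \<otimes>\<^bsub>A\<^esub> z = \<ominus>\<^bsub>A\<^esub> ((x \<otimes>\<^bsub>A\<^esub> z) \<otimes>\<^bsub>A\<^esub> y)"
    using g_alt_right[of x y z] by (simp add: a_minus_def)
  also have "\<dots> = y \<otimes>\<^bsub>A\<^esub> (x \<otimes>\<^bsub>A\<^esub> z)"
    by (rule M.minus_equality) (simp_all add: anticommute)
  also have "\<dots> = \<ominus>\<^bsub>A\<^esub> (x \<otimes>\<^bsub>A\<^esub> (y \<otimes>\<^bsub>A\<^esub> z))"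
  proof -
    have "(y \<otimes>\<^bsub>A\<^esub> x) \<otimes>\<^bsub>A\<^esub> z \<oplus>\<^bsub>A\<^esub> (x \<otimes>\<^bsub>A\<^esub> y) \<otimes>\<^bsub>A\<^esub> z = \<zero>\<^bsub>A\<^esub>"
      by (simp add: anticommute mult_zero_l flip: mult_l_distr)
    then show ?thesis
      using g_alt_left[of y x z] by (simp add: a_minus_def)
  qed
  finally show ?thesis .
qed

lemma mult_neg_l:
  assumes [simp]: "x \<in> carrier A" "y \<in> carrier A"
  shows "(\<ominus>\<^bsub>A\<^esub> x) \<otimes>\<^bsub>A\<^esub> y = \<ominus>\<^bsub>A\<^esub> (x \<otimes>\<^bsub>A\<^esub> y)"
  by (rule M.minus_equality[symmetric])
     (simp_all add: M.l_neg mult_zero_l flip: mult_l_distr)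

text \<open>Two rebracketings lead from $((xy)z)w$ to $x(y(zw))$ through $(xy)(zw)$, but three through
  $(x(yz))w$ and $x((yz)w)$; each changes the sign.\<close>

lemma four_product_double:
  assumes [simp]: "x \<in> carrier A" "y \<in> carrier A" "z \<in> carrier A" "w \<in> carrier A"
  defines "P \<equiv> ((x \<otimes>\<^bsub>A\<^esub> y) \<otimes>\<^bsub>A\<^esub> z) \<otimes>\<^bsub>A\<^esub> w"
  shows "P \<oplus>\<^bsub>A\<^esub> P = \<zero>\<^bsub>A\<^esub>"
proof -
  define T where "T = x \<otimes>\<^bsub>A\<^esub> (y \<otimes>\<^bsub>A\<^esub> (z \<otimes>\<^bsub>A\<^esub> w))"
  have T [simp]: "T \<in> carrier A" by (simp add: T_def)
  have "P = T"
    by (simp add: P_def T_def antiassoc[of "x \<otimes>\<^bsub>A\<^esub> y" z w] antiassoc[of x y "z \<otimes>\<^bsub>A\<^esub> w"])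
  moreover have "P = x \<otimes>\<^bsub>A\<^esub> ((y \<otimes>\<^bsub>A\<^esub> z) \<otimes>\<^bsub>A\<^esub> w)"
    by (simp add: P_def antiassoc[of x y z] mult_neg_l antiassoc[of x "y \<otimes>\<^bsub>A\<^esub> z" w])
  then have "P \<oplus>\<^bsub>A\<^esub> T = \<zero>\<^bsub>A\<^esub>"
    by (simp add: T_def antiassoc[of y z w] M.l_neg mult_zero_r flip: mult_r_distr)
  ultimately show ?thesis by simp
qed

text \<open>Three applications of the annihilator criterion replace x + x by twice a product of four
  factors with \<open>x\<close> in front.\<close>

lemma double_zero:
  assumes x [simp]: "x \<in> carrier A"
  shows "x \<oplus>\<^bsub>A\<^esub> x = \<zero>\<^bsub>A\<^esub>"
  by (rule zero_if_annihilates, simp, rule zero_if_annihilates, simp, rule zero_if_annihilates)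
     (simp_all add: mult_l_distr four_product_double)

lemma minus_eq_self [simp]: "x \<in> carrier A \<Longrightarrow> \<ominus>\<^bsub>A\<^esub> x = x"
  by (rule M.minus_equality) (simp_all add: double_zero)

lemma mult_commute: "\<lbrakk>x \<in> carrier A; y \<in> carrier A\<rbrakk> \<Longrightarrow> x \<otimes>\<^bsub>A\<^esub> y = y \<otimes>\<^bsub>A\<^esub> x"
  using M.minus_equality[OF anticommute, of y x] by simp

text \<open>The right-hand sides of the action identities take this shape once left and right
  actions agree.\<close>

lemma double_minus [simp]:
  "\<lbrakk>x \<in> carrier A; y \<in> carrier A\<rbrakk> \<Longrightarrow> x \<oplus>\<^bsub>A\<^esub> x \<ominus>\<^bsub>A\<^esub> y = y"
  by (simp add: double_zero a_minus_def)

section \<open>Multipliers of \<open>A\<close>\<close>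

text \<open>As \<open>A\<close> is commutative here, these maps form the centroid of
  \<open>A\<close>: the linear maps commuting with all multiplications. Extensionality matches the
  encoding of pairs, whose components are restricted to the carrier.\<close>

definition multiplier :: "('a \<Rightarrow> 'a) \<Rightarrow> bool" where
  "multiplier f \<longleftrightarrow> f \<in> extensional (carrier A) \<and> f ` carrier A \<subseteq> carrier A \<and>
    (\<forall>x \<in> carrier A. \<forall>y \<in> carrier A. f (x \<oplus>\<^bsub>A\<^esub> y) = f x \<oplus>\<^bsub>A\<^esub> f y) \<and>
    (\<forall>c \<in> carrier F. \<forall>x \<in> carrier A. f (c \<odot>\<^bsub>A\<^esub> x) = c \<odot>\<^bsub>A\<^esub> f x) \<and>
    (\<forall>x \<in> carrier A. \<forall>y \<in> carrier A. f (x \<otimes>\<^bsub>A\<^esub> y) = x \<otimes>\<^bsub>A\<^esub> f y)"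

lemma multiplierD:
  assumes "multiplier f"
  shows "f \<in> extensional (carrier A)"
    and "x \<in> carrier A \<Longrightarrow> f x \<in> carrier A"
    and "\<lbrakk>x \<in> carrier A; y \<in> carrier A\<rbrakk> \<Longrightarrow> f (x \<oplus>\<^bsub>A\<^esub> y) = f x \<oplus>\<^bsub>A\<^esub> f y"
    and "\<lbrakk>c \<in> carrier F; x \<in> carrier A\<rbrakk> \<Longrightarrow> f (c \<odot>\<^bsub>A\<^esub> x) = c \<odot>\<^bsub>A\<^esub> f x"
    and "\<lbrakk>x \<in> carrier A; y \<in> carrier A\<rbrakk> \<Longrightarrow> f (x \<otimes>\<^bsub>A\<^esub> y) = x \<otimes>\<^bsub>A\<^esub> f y"
  using assms unfolding multiplier_def by auto

text \<open>A multiplier can be moved from one factor of a product to the other. Both a f(g(x)) and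
  a g(f(x)) therefore equal f(x) g(a), and the annihilator criterion removes
  \<open>a\<close>.\<close>

lemma multiplier_commute:
  assumes f: "multiplier f" and g: "multiplier g" and x: "x \<in> carrier A"
  shows "f (g x) = g (f x)"
proof -
  note [simp] = x multiplierD(2)[OF f] multiplierD(2)[OF g]
  \<comment> \<open>The sum plays the role of the difference, because every element of
    \<open>A\<close> is its own negative.\<close>
  have "(f (g x) \<oplus>\<^bsub>A\<^esub> g (f x)) \<otimes>\<^bsub>A\<^esub> a = \<zero>\<^bsub>A\<^esub>" if [simp]: "a \<in> carrier A" for a
  proof -
    have "a \<otimes>\<^bsub>A\<^esub> f (g x) = f (g (x \<otimes>\<^bsub>A\<^esub> a))"
      by (simp add: mult_commute[of x a] multiplierD(5)[OF f] multiplierD(5)[OF g])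
    also have "\<dots> = f x \<otimes>\<^bsub>A\<^esub> g a"
      by (simp add: mult_commute[of "f x"] mult_commute[of x "g a"]
          multiplierD(5)[OF f] multiplierD(5)[OF g])
    also have "\<dots> = g (a \<otimes>\<^bsub>A\<^esub> f x)"
      by (simp add: mult_commute[of a] multiplierD(5)[OF g])
    also have "\<dots> = a \<otimes>\<^bsub>A\<^esub> g (f x)"
      by (simp add: multiplierD(5)[OF g])
    finally have "a \<otimes>\<^bsub>A\<^esub> (f (g x) \<oplus>\<^bsub>A\<^esub> g (f x)) = \<zero>\<^bsub>A\<^esub>"
      by (simp add: mult_r_distr double_zero)
    then show ?thesis
      by (simp add: mult_commute[of _ a])
  qed
  then have "f (g x) \<oplus>\<^bsub>A\<^esub> g (f x) = \<zero>\<^bsub>A\<^esub>"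
    by (rule zero_if_annihilates[rotated]) simp_all
  then show ?thesis
    using M.minus_equality[of "f (g x)" "g (f x)"] by simp
qed

section \<open>Elements of B(A) as diagonal pairs of multipliers\<close>

text \<open>From ba + ab = 0 and -x = x the two actions of b coincide. Then (bx)y and (xb)y cancel
  in \<open>act1\<close>, which leaves b(xy) = x(by).\<close>

lemma action_pair_multiplier:
  assumes "p \<in> all_action_pairs F A"
  shows "\<exists>f. multiplier f \<and> p = (f, f)"
proof -
  obtain B :: "('f, 'f alg_term) module" and lact ract b
    where p: "p = (\<lambda>a \<in> carrier A. lact b a, \<lambda>a \<in> carrier A. ract a b)"
      and act: "derived_action F B A lact ract" and b: "b \<in> carrier B"
    using assms unfolding all_action_pairs_def action_pairs_def by blast
  interpret D: derived_action F B A lact ract by (rule act)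
  note bil = D.lact_bilinear D.ract_bilinear
  have closed: "lact b a \<in> carrier A" "ract a b \<in> carrier A" if "a \<in> carrier A" for a
    using that b bil unfolding bilinear_map_def by simp_all
  have eq: "ract a b = lact b a" if a: "a \<in> carrier A" for a
  proof -
    have "lact b a \<oplus>\<^bsub>A\<^esub> ract a b = \<zero>\<^bsub>A\<^esub>"
      using action_pair_anticommute[OF assms a] closed[OF a]
      by (simp only: p restrict_apply' fst_conv snd_conv a)
    from M.minus_equality[OF this] show ?thesis
      using closed[OF a] by simp
  qed
  have "lact b (x \<otimes>\<^bsub>A\<^esub> y) = x \<otimes>\<^bsub>A\<^esub> lact b y" if "x \<in> carrier A" "y \<in> carrier A" for x y
    using D.act1[OF b that] that closed by (simp add: eq)
  then have "multiplier (\<lambda>a \<in> carrier A. lact b a)"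
    using b bil closed unfolding multiplier_def bilinear_map_def by auto
  moreover have "p = (\<lambda>a \<in> carrier A. lact b a, \<lambda>a \<in> carrier A. lact b a)"
    using eq by (auto simp: p)
  ultimately show ?thesis by blast
qed

lemma pair_add_diag: "pair_add A (f, f) (g, g) = (\<lambda>a \<in> carrier A. f a \<oplus>\<^bsub>A\<^esub> g a, \<lambda>a \<in> carrier A. f a \<oplus>\<^bsub>A\<^esub> g a)"
  by (simp add: pair_add_def)

lemma pair_neg_diag:
  assumes "multiplier f"
  shows "pair_neg A (f, f) = (f, f)"
  using multiplierD(1,2)[OF assms] by (auto simp: pair_neg_def extensional_def)

text \<open>Since \<open>f\<close> and \<open>g\<close> commute, all three terms in each component
  of the product are f(g(a)), and two of them cancel.\<close>

lemma pair_mult_diag: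
  assumes "multiplier f" "multiplier g"
  shows "pair_mult A (f, f) (g, g) = (\<lambda>a \<in> carrier A. f (g a), \<lambda>a \<in> carrier A. f (g a))"
  using multiplierD(2)[OF assms(1)] multiplierD(2)[OF assms(2)]
  by (auto simp: pair_mult_def multiplier_commute[OF assms] cong: restrict_cong)

lemma multiplier_add:
  assumes "multiplier f" "multiplier g"
  shows "multiplier (\<lambda>a \<in> carrier A. f a \<oplus>\<^bsub>A\<^esub> g a)"
  using multiplierD[OF assms(1)] multiplierD[OF assms(2)]
  unfolding multiplier_def by (auto simp: M.a_ac smult_r_distr mult_r_distr)

lemma multiplier_comp:
  assumes "multiplier f" "multiplier g"
  shows "multiplier (\<lambda>a \<in> carrier A. f (g a))"
  using multiplierD[OF assms(1)] multiplierD[OF assms(2)]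
  unfolding multiplier_def by auto

text \<open>Induction over the generation of B(A): diagonal pairs of multipliers are closed under
  sum, negation and product.\<close>

lemma usga_multiplier:
  assumes "p \<in> usga_carrier F A"
  obtains f where "multiplier f" "p = (f, f)"
proof -
  have "\<exists>f. multiplier f \<and> p = (f, f)"
    using assms
  proof induction
    case (base p)
    then show ?case by (rule action_pair_multiplier)
  next
    case (add p q)
    then show ?case using multiplier_add pair_add_diag by metis
  next
    case (neg p)
    then show ?case using pair_neg_diag by metis
  next
    case (mult p q)
    then show ?case using multiplier_comp pair_mult_diag by metis
  qed
  then show ?thesis using that by blast
qed

lemma usga_fst:
  assumes "p \<in> usga_carrier F A"
  shows "multiplier (fst p)" "snd p = fst p"
  using assms by (auto elim: usga_multiplier)

text \<open>Equations in B(A) thereby become pointwise equations in \<open>A\<close> between first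
  components.\<close>

lemma usga_eqI:
  assumes "p \<in> usga_carrier F A" "q \<in> usga_carrier F A"
    and "\<And>a. a \<in> carrier A \<Longrightarrow> fst p a = fst q a"
  shows "p = q"
proof -
  have "fst p = fst q"
    using assms usga_fst(1) multiplierD(1) by (blast intro: extensionalityI)
  then show ?thesis
    using assms usga_fst(2) by (simp add: prod_eq_iff)
qed

lemma fst_usga_add:
  "a \<in> carrier A \<Longrightarrow> fst (pair_add A p q) a = fst p a \<oplus>\<^bsub>A\<^esub> fst q a"
  by (simp add: pair_add_def)

lemma fst_usga_mult:
  assumes "p \<in> usga_carrier F A" "q \<in> usga_carrier F A" "a \<in> carrier A"
  shows "fst (pair_mult A p q) a = fst p (fst q a)"
proof -
  obtain f g where "multiplier f" "p = (f, f)" "multiplier g" "q = (g, g)"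
    using assms usga_multiplier by metis
  then show ?thesis
    using assms(3) by (simp add: pair_mult_diag)
qed

section \<open>Zero and scalar multiples in B(A)\<close>

text \<open>Zero is not introduced by a rule of \<open>usga_carrier\<close>; it arises as the action
  of the zero of \<open>A\<close> by multiplication.\<close>

lemma usga_zero_closed: "\<zero>\<^bsub>usga F A\<^esub> \<in> usga_carrier F A"
proof -
  have "\<zero>\<^bsub>usga F A\<^esub> = (\<lambda>a \<in> carrier A. \<zero>\<^bsub>A\<^esub> \<otimes>\<^bsub>A\<^esub> a, \<lambda>a \<in> carrier A. a \<otimes>\<^bsub>A\<^esub> \<zero>\<^bsub>A\<^esub>)"
    by (auto simp: usga_def mult_zero_l mult_zero_r)
  then show ?thesis
    using mult_in_all_action_pairs[OF g_alternative_axioms M.zero_closed] usga_carrier.base by metis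
qed

text \<open>Scaling is not a generating operation of B(A) either. On acting elements it is absorbed
  by replacing b with the scalar multiple of b in its own algebra.\<close>

lemma action_pair_smult_closed:
  assumes "p \<in> all_action_pairs F A" "c \<in> carrier F"
  shows "c \<odot>\<^bsub>usga F A\<^esub> p \<in> all_action_pairs F A"
proof -
  obtain B :: "('f, 'f alg_term) module" and lact ract b
    where p: "p = (\<lambda>a \<in> carrier A. lact b a, \<lambda>a \<in> carrier A. ract a b)"
      and act: "derived_action F B A lact ract" and b: "b \<in> carrier B"
    using assms unfolding all_action_pairs_def action_pairs_def by blast
  interpret D: derived_action F B A lact ract by (rule act)
  have "c \<odot>\<^bsub>A\<^esub> lact b a = lact (c \<odot>\<^bsub>B\<^esub> b) a" "c \<odot>\<^bsub>A\<^esub> ract a b = ract a (c \<odot>\<^bsub>B\<^esub> b)"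
    if "a \<in> carrier A" for a
    using that assms(2) b D.lact_bilinear D.ract_bilinear unfolding bilinear_map_def by simp_all
  then have "c \<odot>\<^bsub>usga F A\<^esub> p =
      (\<lambda>a \<in> carrier A. lact (c \<odot>\<^bsub>B\<^esub> b) a, \<lambda>a \<in> carrier A. ract a (c \<odot>\<^bsub>B\<^esub> b))"
    by (auto simp: p usga_def)
  moreover have "c \<odot>\<^bsub>B\<^esub> b \<in> carrier B"
    using assms(2) b by simp
  ultimately show ?thesis
    using act unfolding all_action_pairs_def action_pairs_def by blast
qed

lemma usga_smult_closed:
  assumes "p \<in> usga_carrier F A" and c: "c \<in> carrier F"
  shows "c \<odot>\<^bsub>usga F A\<^esub> p \<in> usga_carrier F A"
  using assms(1)
proof induction
  case (base p)
  then show ?case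
    using action_pair_smult_closed c usga_carrier.base by blast
next
  case (add p q)
  have "c \<odot>\<^bsub>usga F A\<^esub> pair_add A p q = pair_add A (c \<odot>\<^bsub>usga F A\<^esub> p) (c \<odot>\<^bsub>usga F A\<^esub> q)"
    using multiplierD(2)[OF usga_fst(1)[OF add.hyps(1)]] multiplierD(2)[OF usga_fst(1)[OF add.hyps(2)]]
      usga_fst(2)[OF add.hyps(1)] usga_fst(2)[OF add.hyps(2)] c
    by (auto simp: usga_def pair_add_def smult_r_distr)
  then show ?case
    using add.IH by (simp add: usga_carrier.add)
next
  case (neg p)
  then show ?case
    using usga_multiplier pair_neg_diag by metis
next
  case (mult p q)
  \<comment> \<open>The scalar is moved into the first factor only; homogeneity of the maps of
    \<open>q\<close> handles the term in which they are applied last.\<close>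
  have "c \<odot>\<^bsub>usga F A\<^esub> pair_mult A p q = pair_mult A (c \<odot>\<^bsub>usga F A\<^esub> p) q"
  proof -
    note [simp] = multiplierD(2,4)[OF usga_fst(1)[OF mult.hyps(1)]]
      multiplierD(2,4)[OF usga_fst(1)[OF mult.hyps(2)]]
      usga_fst(2)[OF mult.hyps(1)] usga_fst(2)[OF mult.hyps(2)]
    show ?thesis
      using c by (auto simp: usga_def pair_mult_def double_zero a_minus_def smult_r_distr)
  qed
  then show ?case
    using mult.IH(1) mult.hyps(2) by (simp add: usga_carrier.mult)
qed

lemma usga_sel [simp]:
  "carrier (usga F A) = usga_carrier F A"
  "p \<otimes>\<^bsub>usga F A\<^esub> q = pair_mult A p q"
  "p \<oplus>\<^bsub>usga F A\<^esub> q = pair_add A p q"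
  by (simp_all add: usga_def)

lemma fst_usga_zero: "a \<in> carrier A \<Longrightarrow> fst \<zero>\<^bsub>usga F A\<^esub> a = \<zero>\<^bsub>A\<^esub>"
  by (simp add: usga_def)

lemma fst_usga_smult: "a \<in> carrier A \<Longrightarrow> fst (c \<odot>\<^bsub>usga F A\<^esub> p) a = c \<odot>\<^bsub>A\<^esub> fst p a"
  by (simp add: usga_def)

lemma fst_usga_commute:
  "\<lbrakk>p \<in> usga_carrier F A; q \<in> usga_carrier F A; a \<in> carrier A\<rbrakk> \<Longrightarrow> fst p (fst q a) = fst q (fst p a)"
  by (intro multiplier_commute usga_fst)

lemma fst_usga_closed: "\<lbrakk>p \<in> usga_carrier F A; a \<in> carrier A\<rbrakk> \<Longrightarrow> fst p a \<in> carrier A"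
  by (rule multiplierD(2)[OF usga_fst(1)])

lemmas fst_usga_simps = fst_usga_closed usga_carrier.add usga_carrier.mult usga_zero_closed
  usga_smult_closed fst_usga_add fst_usga_mult fst_usga_zero fst_usga_smult
  multiplierD(3,4,5)[OF usga_fst(1)] smult_r_distr smult_l_distr smult_assoc1

section \<open>B(A) as a g-alternative algebra and its derived action\<close>

text \<open>The product is composition of commuting maps, so all triple products in either identity
  are one and the same element t, and the identity reads t = t + t - t.\<close>

lemma usga_g_alternative: "g_alternative F (usga F A)"
proof -
  have double: "pair_add A p p = \<zero>\<^bsub>usga F A\<^esub>" if "p \<in> usga_carrier F A" for p
    using that by (intro usga_eqI) (simp_all add: fst_usga_simps double_zero)
  interpret U: abelian_group "usga F A"
  proof (rule abelian_groupI)
    fix p assume p: "p \<in> carrier (usga F A)"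
    then show "\<exists>q \<in> carrier (usga F A). q \<oplus>\<^bsub>usga F A\<^esub> p = \<zero>\<^bsub>usga F A\<^esub>"
      \<comment> \<open>Each pair is its own additive inverse.\<close>
      using double by (intro bexI[of _ p]) simp_all
    show "\<zero>\<^bsub>usga F A\<^esub> \<oplus>\<^bsub>usga F A\<^esub> p = p"
      using p by (intro usga_eqI) (simp_all add: fst_usga_simps)
    fix q assume q: "q \<in> carrier (usga F A)"
    show "p \<oplus>\<^bsub>usga F A\<^esub> q = q \<oplus>\<^bsub>usga F A\<^esub> p"
      using p q by (intro usga_eqI) (simp_all add: fst_usga_simps M.a_comm)
    fix r assume r: "r \<in> carrier (usga F A)"
    show "(p \<oplus>\<^bsub>usga F A\<^esub> q) \<oplus>\<^bsub>usga F A\<^esub> r = p \<oplus>\<^bsub>usga F A\<^esub> (q \<oplus>\<^bsub>usga F A\<^esub> r)"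
      using p q r by (intro usga_eqI) (simp_all add: fst_usga_simps M.a_assoc)
  qed (simp_all add: fst_usga_simps)
  have minus: "p \<ominus>\<^bsub>usga F A\<^esub> q = pair_add A p q"
    if "p \<in> usga_carrier F A" "q \<in> usga_carrier F A" for p q
    using that U.minus_equality[of q q] double by (simp add: a_minus_def)
  have "module F (usga F A)"
    by (intro moduleI is_cring U.abelian_group_axioms; (rule usga_eqI)?; simp add: fst_usga_simps)
  moreover have "bilinear_map F (usga F A) (usga F A) (usga F A) (mult (usga F A))"
    unfolding bilinear_map_def by (intro conjI ballI usga_eqI) (simp_all add: fst_usga_simps)
  ultimately have "nonassoc_algebra F (usga F A)"
    by (intro nonassoc_algebra.intro nonassoc_algebra_axioms.intro field_axioms)
  then show ?thesis
  proof (intro g_alternative.intro g_alternative_axioms.intro)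
    fix p q r
    assume "p \<in> carrier (usga F A)" "q \<in> carrier (usga F A)" "r \<in> carrier (usga F A)"
    then have pqr: "p \<in> usga_carrier F A" "q \<in> usga_carrier F A" "r \<in> usga_carrier F A"
      by simp_all
    show "p \<otimes>\<^bsub>usga F A\<^esub> (q \<otimes>\<^bsub>usga F A\<^esub> r) =
        (p \<otimes>\<^bsub>usga F A\<^esub> q) \<otimes>\<^bsub>usga F A\<^esub> r \<oplus>\<^bsub>usga F A\<^esub> (q \<otimes>\<^bsub>usga F A\<^esub> p) \<otimes>\<^bsub>usga F A\<^esub> r
          \<ominus>\<^bsub>usga F A\<^esub> q \<otimes>\<^bsub>usga F A\<^esub> (p \<otimes>\<^bsub>usga F A\<^esub> r)"
      using pqr by (intro usga_eqI) (simp_all add: minus fst_usga_simps fst_usga_commute double_zero)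
    show "(p \<otimes>\<^bsub>usga F A\<^esub> q) \<otimes>\<^bsub>usga F A\<^esub> r =
        p \<otimes>\<^bsub>usga F A\<^esub> (q \<otimes>\<^bsub>usga F A\<^esub> r) \<oplus>\<^bsub>usga F A\<^esub> p \<otimes>\<^bsub>usga F A\<^esub> (r \<otimes>\<^bsub>usga F A\<^esub> q)
          \<ominus>\<^bsub>usga F A\<^esub> (p \<otimes>\<^bsub>usga F A\<^esub> r) \<otimes>\<^bsub>usga F A\<^esub> q"
      using pqr by (intro usga_eqI) (simp_all add: minus fst_usga_simps fst_usga_commute double_zero)
  qed
qed

text \<open>With equal left and right actions, each of the eight identities again reads t = t + t -
  t. The permutative rules \<open>swap\<close> and \<open>fst_usga_commute\<close> bring the four
  terms to one normal form.\<close>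

lemma usga_derived_action: "derived_action F (usga F A) A usga_lact usga_ract"
proof -
  have mult_l: "fst p x \<otimes>\<^bsub>A\<^esub> y = x \<otimes>\<^bsub>A\<^esub> fst p y"
    if "p \<in> usga_carrier F A" "x \<in> carrier A" "y \<in> carrier A" for p x y
    using that multiplierD(5)[OF usga_fst(1), of p x y] multiplierD(5)[OF usga_fst(1), of p y x]
      mult_commute[of x y] mult_commute[of "fst p x" y] fst_usga_closed
    by simp
  have swap: "x \<otimes>\<^bsub>A\<^esub> fst p y = y \<otimes>\<^bsub>A\<^esub> fst p x"
    if "p \<in> usga_carrier F A" "x \<in> carrier A" "y \<in> carrier A" for p x y
    using that mult_l[OF that] mult_commute[of "fst p x" y] fst_usga_closed by simp
  have ract: "usga_ract a p = fst p a" if "p \<in> usga_carrier F A" for a p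
    using that by (simp add: usga_ract_def usga_fst(2))
  show ?thesis
  proof (intro derived_action.intro derived_action_axioms.intro
      g_alternative_axioms usga_g_alternative)
    show "bilinear_map F (usga F A) A A usga_lact"
      unfolding bilinear_map_def by (auto simp: usga_lact_def fst_usga_simps)
    show "bilinear_map F A (usga F A) A usga_ract"
      unfolding bilinear_map_def by (auto simp: ract fst_usga_simps)
  qed (simp_all add: usga_lact_def ract fst_usga_simps mult_l swap fst_usga_commute)
qed

section \<open>The universal property\<close>

lemma usga_universal:
  fixes C :: "('f, 'c) module"
  assumes act: "derived_action F C A lact ract"
  shows "\<exists>!\<phi>. \<phi> \<in> alg_hom F C (usga F A) \<and>
    (\<forall>c \<in> carrier C. \<forall>a \<in> carrier A. lact c a = usga_lact (\<phi> c) a \<and> ract a c = usga_ract a (\<phi> c))"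
proof -
  interpret D: derived_action F C A lact ract by (rule act)
  \<comment> \<open>Each c goes to the pair of maps by which it acts. Compatibility with products is
    exactly \<open>act5\<close> and \<open>act6\<close>, whose right-hand sides define the product
    of pairs.\<close>
  define \<phi> where "\<phi> = (\<lambda>c \<in> carrier C. (\<lambda>a \<in> carrier A. lact c a, \<lambda>a \<in> carrier A. ract a c))"
  note bil = D.lact_bilinear[unfolded bilinear_map_def] D.ract_bilinear[unfolded bilinear_map_def]
  show ?thesis
  proof (intro ex1I[of _ \<phi>] conjI ballI)
    have "\<phi> c \<in> usga_carrier F A" if "c \<in> carrier C" for c
    proof -
      have "\<phi> c \<in> action_pairs TYPE('c) F A"
        using act that unfolding action_pairs_def \<phi>_def by auto
      then show ?thesis
        using action_pairs_subset_all_action_pairs usga_carrier.base by blast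
    qed
    moreover have "\<phi> (x \<oplus>\<^bsub>C\<^esub> y) = pair_add A (\<phi> x) (\<phi> y)" if "x \<in> carrier C" "y \<in> carrier C" for x y
      using that bil by (auto simp: \<phi>_def pair_add_def)
    moreover have "\<phi> (x \<otimes>\<^bsub>C\<^esub> y) = pair_mult A (\<phi> x) (\<phi> y)" if "x \<in> carrier C" "y \<in> carrier C" for x y
      using that bil D.B.mult_closed D.act5 D.act6 by (auto simp: \<phi>_def pair_mult_def)
    moreover have "\<phi> (k \<odot>\<^bsub>C\<^esub> x) = k \<odot>\<^bsub>usga F A\<^esub> \<phi> x" if "k \<in> carrier F" "x \<in> carrier C" for k x
      using that bil by (auto simp: \<phi>_def usga_def)
    moreover have "\<phi> \<in> extensional (carrier C)"
      by (simp add: \<phi>_def)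
    ultimately show "\<phi> \<in> alg_hom F C (usga F A)"
      by (simp add: alg_hom_def PiE_iff)
  next
    fix \<psi>
    assume \<psi>: "\<psi> \<in> alg_hom F C (usga F A) \<and>
      (\<forall>c \<in> carrier C. \<forall>a \<in> carrier A. lact c a = usga_lact (\<psi> c) a \<and> ract a c = usga_ract a (\<psi> c))"
    have "\<psi> c = \<phi> c" if c: "c \<in> carrier C" for c
    proof -
      have "\<psi> c \<in> usga_carrier F A"
        using \<psi> c by (auto simp: alg_hom_def)
      \<comment> \<open>Uniqueness: both components are determined by their values on
        \<open>A\<close>, and these are prescribed by the action of c.\<close>
      then have "fst (\<psi> c) \<in> extensional (carrier A)" "snd (\<psi> c) \<in> extensional (carrier A)"
        using usga_fst multiplierD(1) by auto
      then show ?thesis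
        using \<psi> c
        by (auto simp: \<phi>_def usga_lact_def usga_ract_def prod_eq_iff intro!: extensionalityI[of _ "carrier A"])
    qed
    moreover have "\<psi> \<in> extensional (carrier C)" "\<phi> \<in> extensional (carrier C)"
      using \<psi> by (simp_all add: alg_hom_def PiE_iff \<phi>_def)
    ultimately show "\<psi> = \<phi>"
      by (blast intro: extensionalityI)
  qed (simp_all add: \<phi>_def usga_lact_def usga_ract_def)
qed

end

theorem corollary6p2:
  fixes F :: "('f, 'k) ring_scheme"
    and A :: "('f, 'a, 'm) module_scheme"
  assumes "g_alternative F A"
    and "Asoci F A = {\<zero>\<^bsub>A\<^esub>}"
  shows "is_actor TYPE('c) F A (usga F A) usga_lact usga_ract"
proof -
  interpret asoci_zero F A
    using assms by (intro asoci_zero.intro asoci_zero_axioms.intro)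
  show ?thesis
    unfolding is_actor_def using usga_derived_action usga_universal by blast
qed

end
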